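(* There exists $d_0$ such that for every integer $d\ge d_0$ there exists $n_0$ such that for every even $n\ge n_0$, every $k$ with $1\le k\le n/100$, and every $S\subset V=[n]$ with $|S|=k$, a sample $H\sim\mathcal{G}_{\mathrm{reg}}(n,d)$ satisfies, with probability at least $1-2\binom{n}{k}^{-1.01}$, \[ \left| \frac{\mathrm{cut}_H(S)}{\mathbb{E}_{H\sim\mathcal{G}_{\mathrm{reg}}(n,d)}[\mathrm{cut}_H(S)]} - 1\right| \le \frac{1.5}{\sqrt d}. \]
   Context: $\mathcal{G}_{\mathrm{reg}}(n,d)$ ($n$ even) is the distribution of the $d$-regular multigraph on $[n]$ obtained as the disjoint union of $d$ independent uniformly random perfect matchings. $\mathrm{cut}_H(S)$ is the number of edges (with multiplicity) of $H$ with exactly one endpoint in $S$. *)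

theory Defs
  imports "HOL-Probability.Probability" "HOL-Library.Disjoint_Sets"
begin

definition perfect_matchings :: "'a set \<Rightarrow> 'a set set set" where
  "perfect_matchings V = {M. partition_on V M \<and> (\<forall>e\<in>M. card e = 2)}"

lemma finite_perfect_matchings:
  assumes "finite V"
  shows "finite (perfect_matchings V)"
  by (rule finite_subset[OF _ finitely_many_partition_on[OF assms]])
     (auto simp: perfect_matchings_def)

text \<open>The junk value of \<^const>\<open>pmf_of_set\<close> on the empty set is never reached for even \<open>n\<close>:\<close>

lemma perfect_matchings_nonempty:
  fixes n :: nat
  assumes "even n"
  shows "perfect_matchings {1..n} \<noteq> {}"
proof -
  let ?M = "(\<lambda>i. {2 * i + 1, 2 * i + 2}) ` {..<n div 2}"
  have "\<exists>i<n div 2. v = Suc (2 * i) \<or> v = Suc (Suc (2 * i))" if "1 \<le> v" "v \<le> n" for v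
    using that assms by (intro exI[of _ "(v - 1) div 2"]) presburger
  then have "\<Union>?M = {1..n}"
    using assms by fastforce
  moreover have "disjoint ?M"
    by (auto simp: disjoint_def) presburger+
  ultimately have "?M \<in> perfect_matchings {1..n}"
    unfolding perfect_matchings_def partition_on_def by auto
  then show ?thesis by blast
qed

text \<open>A loopless multigraph is represented by the multiset of its edges, an edge being the set of
  its two endpoints.\<close>

definition G_reg :: "nat \<Rightarrow> nat \<Rightarrow> nat set multiset pmf" where
  "G_reg n d =
     map_pmf (\<lambda>M. \<Sum>i<d. mset_set (M i))
       (Pi_pmf {..<d} {} (\<lambda>_. pmf_of_set (perfect_matchings {1..n})))"

definition cut_size :: "'a set multiset \<Rightarrow> 'a set \<Rightarrow> nat" where
  "cut_size H S = size {#e \<in># H. card (e \<inter> S) = 1#}"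

end

theory Submission
  imports Defs
begin

text \<open>
  Let \<open>I\<close> be the number of edges of a uniform perfect matching inside \<open>S\<close>, so that the matching
  contributes \<open>k - 2 * I\<close> to the cut. The generating function \<open>F(n,k)(x)\<close> of \<open>I\<close> satisfies
  \<open>F(n,k)' = \<mu> * F(n-2,k-2)\<close> with \<open>\<mu>\<close> the mean of \<open>I\<close>. Since \<open>F(n-2,k-2)\<close> lies above \<open>F(n,k)\<close>
  for \<open>x \<le> 1\<close> and below it for \<open>x \<ge> 1\<close>, the function \<open>F(n,k)(x) * exp (- \<mu> * (x - 1))\<close> has its
  maximum at \<open>x = 1\<close>; hence \<open>I\<close> obeys the Poisson bound \<open>F(n,k)(x) \<le> exp (\<mu> * (x - 1))\<close> for
  all \<open>x \<ge> 0\<close>. Chernoff's method with \<open>x = exp (\<plusminus> 2 * w / sqrt d)\<close>, where \<open>w = 1 + ln (n / k)\<close>,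
  bounds both tails by \<open>exp (- 1.01 * k * w)\<close>, and \<open>n choose k \<le> exp (k * w)\<close>.
\<close>

section \<open>Perfect matchings: splitting off an edge, counting\<close>

definition inner_edges :: "'a set set \<Rightarrow> 'a set \<Rightarrow> nat" where
  "inner_edges M S = card {e \<in> M. e \<subseteq> S}"

lemma perfect_matching_finite:
  assumes "finite V" "M \<in> perfect_matchings V"
  shows "finite M"
  using assms finite_elements unfolding perfect_matchings_def by blast

lemma perfect_matchings_empty: "perfect_matchings {} = {{}}"
  by (auto simp: perfect_matchings_def partition_on_empty)

lemma insert_edge_perfect_matching:
  assumes "a \<in> V" "b \<in> V" "a \<noteq> b" "M \<in> perfect_matchings (V - {a, b})"
  shows "insert {a, b} M \<in> perfect_matchings V"
proof -
  have "partition_on (V - {a, b}) M"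
    using assms by (simp add: perfect_matchings_def)
  then have "partition_on V (insert {a, b} M)"
    using assms partition_on_insert[of "{a, b}" M V]
    by (auto simp: partition_on_def disjoint_def disjnt_def)
  then show ?thesis
    using assms by (auto simp: perfect_matchings_def)
qed

lemma remove_edge_perfect_matching:
  assumes "{a, b} \<in> M" "M \<in> perfect_matchings V"
  shows "M - {{a, b}} \<in> perfect_matchings (V - {a, b})"
proof -
  have p: "partition_on V M" and c: "\<forall>e\<in>M. card e = 2"
    using assms by (simp_all add: perfect_matchings_def)
  have "\<Union>(M - {{a, b}}) = V - {a, b}"
  proof -
    have "e \<inter> {a, b} = {}" if "e \<in> M" "e \<noteq> {a, b}" for e
      using disjointD[of M e "{a, b}"] p that assms(1) by (simp add: partition_on_def)
    moreover have "\<Union>M = V"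
      using p by (simp add: partition_on_def)
    ultimately show ?thesis using assms(1) by fastforce
  qed
  with p c show ?thesis
    unfolding perfect_matchings_def partition_on_def disjoint_def by auto
qed

text \<open>A perfect matching is determined by the partner \<open>b\<close> of \<open>a\<close>
  together with the matching left on the other vertices.\<close>

lemma bij_betw_insert_edge:
  assumes "a \<in> V"
  shows "bij_betw (\<lambda>(b, M). insert {a, b} M)
    (SIGMA b:V - {a}. perfect_matchings (V - {a, b})) (perfect_matchings V)"
  unfolding bij_betw_def
proof (intro conjI)
  \<comment> \<open>No edge of the remaining matching contains \<open>a\<close>, so the inserted
    edge is recovered as the one through \<open>a\<close>.\<close>
  have notin: "{a, c} \<notin> M" if "M \<in> perfect_matchings (V - {a, b})" for b c and M
    using that unfolding perfect_matchings_def partition_on_def by auto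
  show "inj_on (\<lambda>(b, M). insert {a, b} M) (SIGMA b:V - {a}. perfect_matchings (V - {a, b}))"
  proof (rule inj_onI)
    fix p q
    assume "p \<in> (SIGMA b:V - {a}. perfect_matchings (V - {a, b}))"
      "q \<in> (SIGMA b:V - {a}. perfect_matchings (V - {a, b}))"
      "(\<lambda>(b, M). insert {a, b} M) p = (\<lambda>(b, M). insert {a, b} M) q"
    then obtain b M c N where pq: "p = (b, M)" "q = (c, N)"
      and *: "M \<in> perfect_matchings (V - {a, b})" "N \<in> perfect_matchings (V - {a, c})"
        "insert {a, b} M = insert {a, c} N"
      by auto
    have "{a, b} = {a, c}"
      using notin[OF *(1)] notin[OF *(2)] *(3) by blast
    then have "b = c" by (auto simp: doubleton_eq_iff)
    moreover have "M = N"
      using notin[OF *(1), of b] notin[OF *(2), of b] *(3) \<open>b = c\<close> by (simp add: insert_ident)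
    ultimately show "p = q" using pq by simp
  qed
  show "(\<lambda>(b, M). insert {a, b} M) ` (SIGMA b:V - {a}. perfect_matchings (V - {a, b}))
      = perfect_matchings V"
  proof (intro equalityI subsetI)
    fix M assume "M \<in> (\<lambda>(b, M). insert {a, b} M) ` (SIGMA b:V - {a}. perfect_matchings (V - {a, b}))"
    then show "M \<in> perfect_matchings V"
      using assms by (auto intro: insert_edge_perfect_matching)
  next
    fix M assume M: "M \<in> perfect_matchings V"
    then have "\<Union>M = V" "\<forall>e\<in>M. card e = 2"
      by (auto simp: perfect_matchings_def partition_on_def)
    then obtain e where e: "e \<in> M" "a \<in> e" "card e = 2"
      using assms by blast
    then obtain b where b: "e = {a, b}" "a \<noteq> b"
      by (auto simp: card_2_iff doubleton_eq_iff)
    have "b \<in> V - {a}"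
      using b e \<open>\<Union>M = V\<close> by auto
    moreover have "M - {{a, b}} \<in> perfect_matchings (V - {a, b})"
      using M e(1) unfolding b(1) by (intro remove_edge_perfect_matching)
    moreover have "M = insert {a, b} (M - {{a, b}})"
      using e(1) unfolding b(1) by (simp add: insert_absorb)
    ultimately show "M \<in> (\<lambda>(b, M). insert {a, b} M) ` (SIGMA b:V - {a}. perfect_matchings (V - {a, b}))"
      by (intro image_eqI[of _ _ "(b, M - {{a, b}})"]) auto
  qed
qed

text \<open>Conditioning on the partner of \<open>a\<close>. A constant summand counts the
  matchings; the summand \<open>x ^ inner_edges M S\<close> yields the recursion of
  \<open>matching_pgf\<close>.\<close>

lemma sum_perfect_matchings:
  fixes f :: "'a set set \<Rightarrow> 'b::comm_monoid_add"
  assumes "finite V" "a \<in> V"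
  shows "sum f (perfect_matchings V) =
    (\<Sum>b\<in>V - {a}. \<Sum>M\<in>perfect_matchings (V - {a, b}). f (insert {a, b} M))"
proof -
  have "sum f (perfect_matchings V) =
    (\<Sum>p\<in>(SIGMA b:V - {a}. perfect_matchings (V - {a, b})). f (case p of (b, M) \<Rightarrow> insert {a, b} M))"
    by (rule sum.reindex_bij_betw[OF bij_betw_insert_edge[OF assms(2)], symmetric])
  also have "\<dots> = (\<Sum>(b, M)\<in>(SIGMA b:V - {a}. perfect_matchings (V - {a, b})). f (insert {a, b} M))"
    by (simp add: case_prod_beta)
  also have "\<dots> = (\<Sum>b\<in>V - {a}. \<Sum>M\<in>perfect_matchings (V - {a, b}). f (insert {a, b} M))"
    using assms by (intro sum.Sigma[symmetric]) (auto intro: finite_perfect_matchings)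
  finally show ?thesis .
qed

text \<open>The double factorial (2m-1)!!: a fixed vertex has 2m-1 possible partners, and 2m-2
  vertices remain.\<close>

lemma card_perfect_matchings:
  assumes "finite V" "card V = 2 * m"
  shows "card (perfect_matchings V) = (\<Prod>i<m. 2 * i + 1)"
  using assms
proof (induction m arbitrary: V)
  case 0
  then show ?case by (simp add: perfect_matchings_empty)
next
  case (Suc m)
  then obtain a where a: "a \<in> V" by fastforce
  have "card (perfect_matchings V) = (\<Sum>b\<in>V - {a}. card (perfect_matchings (V - {a, b})))"
    using sum_perfect_matchings[OF Suc.prems(1) a, of "\<lambda>_. 1::nat"] by simp
  also have "\<dots> = (\<Sum>b\<in>V - {a}. \<Prod>i<m. 2 * i + 1)"
  proof (rule sum.cong[OF refl])
    fix b assume "b \<in> V - {a}"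
    then have "card (V - {a, b}) = 2 * m"
      using Suc.prems a by (subst card_Diff_subset) auto
    then show "card (perfect_matchings (V - {a, b})) = (\<Prod>i<m. 2 * i + 1)"
      using Suc by auto
  qed
  also have "\<dots> = (\<Prod>i<Suc m. 2 * i + 1)"
    using Suc.prems a by simp
  finally show ?case .
qed

section \<open>Generating function of the inner edges\<close>

text \<open>\<open>matching_pgf m k\<close> is the probability generating function of the number of edges that a uniform
  perfect matching of \<open>2 * m\<close> vertices has inside a set of \<open>k\<close> vertices; the recursion exposes the
  partner of one vertex of that set.\<close>

fun matching_pgf :: "nat \<Rightarrow> nat \<Rightarrow> real \<Rightarrow> real" where
  "matching_pgf 0 k x = 1"
| "matching_pgf (Suc m) 0 x = 1"
| "matching_pgf (Suc m) (Suc k) x =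
    (real k * x * matching_pgf m (k - 1) x + (2 * real m + 1 - real k) * matching_pgf m k x)
      / (2 * real m + 1)"

lemma matching_pgf_0 [simp]: "matching_pgf m 0 x = 1"
  by (cases m) auto

text \<open>The edges of \<open>M\<close> avoid \<open>a\<close> and \<open>b\<close>, so shrinking
  \<open>S\<close> to \<open>S - {a, b}\<close> loses none of them. The smaller set lies in the
  smaller vertex set, as an induction needs.\<close>

lemma inner_edges_insert_edge:
  assumes "finite V" "a \<in> S" "M \<in> perfect_matchings (V - {a, b})"
  shows "inner_edges (insert {a, b} M) S = (if b \<in> S then 1 else 0) + inner_edges M (S - {a, b})"
proof -
  have U: "\<Union>M = V - {a, b}"
    using assms by (simp add: perfect_matchings_def partition_on_def)
  have fin: "finite M"
    using perfect_matching_finite[OF _ assms(3)] assms(1) by simp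
  have nin: "{a, b} \<notin> M" using U by blast
  have eq: "{e \<in> M. e \<subseteq> S - {a, b}} = {e \<in> M. e \<subseteq> S}"
    using U by blast
  have "{e \<in> insert {a, b} M. e \<subseteq> S} =
      (if b \<in> S then insert {a, b} {e \<in> M. e \<subseteq> S} else {e \<in> M. e \<subseteq> S})"
    using assms(2) by auto
  then show ?thesis
    using fin nin by (simp add: inner_edges_def eq)
qed

text \<open>Induction by the partner \<open>b\<close> of a vertex \<open>a\<close> of
  \<open>S\<close>, with \<open>k = Suc l\<close>. A partner in \<open>S\<close> creates an inner
  edge, hence a factor \<open>x\<close>, and leaves \<open>l - 1\<close> vertices of
  \<open>S\<close>; a partner outside leaves \<open>l\<close>. These are the two terms of the
  recursion.\<close>

lemma sum_power_inner_edges: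
  fixes x :: real
  assumes "finite V" "card V = 2 * m" "S \<subseteq> V" "card S = k"
  shows "(\<Sum>M\<in>perfect_matchings V. x ^ inner_edges M S)
    = card (perfect_matchings V) * matching_pgf m k x"
  using assms
proof (induction m arbitrary: V S k)
  case 0
  then show ?case by (simp add: perfect_matchings_empty inner_edges_def)
next
  case (Suc m)
  show ?case
  proof (cases k)
    case 0
    then have "S = {}"
      using Suc.prems finite_subset by fastforce
    have "inner_edges M S = 0" if "M \<in> perfect_matchings V" for M
    proof -
      have "{e \<in> M. e \<subseteq> S} = {}"
        using that \<open>S = {}\<close> by (auto simp: perfect_matchings_def)
      then show ?thesis by (simp only: inner_edges_def card.empty)
    qed
    then show ?thesis using 0 by simp
  next
    case (Suc l)
    have finS: "finite S" using Suc.prems finite_subset by blast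
    obtain a where a: "a \<in> S" "a \<in> V"
      using Suc Suc.prems by (metis card.empty equals0I nat.distinct(1) subsetD)
    define N :: nat where "N = (\<Prod>i<m. 2 * i + 1)"
    have cV: "card (V - {a, b}) = 2 * m" if "b \<in> V - {a}" for b
      using Suc.prems a that by (subst card_Diff_subset) auto
    have N: "card (perfect_matchings (V - {a, b})) = N" if "b \<in> V - {a}" for b
      unfolding N_def using card_perfect_matchings cV[OF that] Suc.prems(1) by blast
    have NV: "card (perfect_matchings V) = (2 * m + 1) * N"
      using card_perfect_matchings[OF Suc.prems(1,2)] by (simp add: N_def)
    have inside: "(\<Sum>M\<in>perfect_matchings (V - {a, b}). x ^ inner_edges (insert {a, b} M) S)
        = x * (N * matching_pgf m (l - 1) x)" if b: "b \<in> S - {a}" for b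
    proof -
      have "card (S - {a, b}) = l - 1"
        using a b finS Suc Suc.prems by (subst card_Diff_subset) auto
      then have "(\<Sum>M\<in>perfect_matchings (V - {a, b}). x ^ inner_edges M (S - {a, b}))
          = N * matching_pgf m (l - 1) x"
        using Suc.IH[of "V - {a, b}" "S - {a, b}" "l - 1"] N[of b] cV[of b] b Suc.prems by auto
      then show ?thesis
        using b a Suc.prems
        by (simp add: inner_edges_insert_edge[where V = V] sum_distrib_left[symmetric])
    qed
    have outside: "(\<Sum>M\<in>perfect_matchings (V - {a, b}). x ^ inner_edges (insert {a, b} M) S)
        = N * matching_pgf m l x" if b: "b \<in> V - S" for b
    proof -
      have bV: "b \<in> V - {a}" using a b by blast
      have "S - {a, b} = S - {a}" using b by blast
      then have "card (S - {a, b}) = l"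
        using a finS Suc Suc.prems by auto
      then have "(\<Sum>M\<in>perfect_matchings (V - {a, b}). x ^ inner_edges M (S - {a, b}))
          = N * matching_pgf m l x"
        using Suc.IH[of "V - {a, b}" "S - {a, b}" "l"] N[OF bV] cV[OF bV] Suc.prems(1,3) by auto
      then show ?thesis
        using b a Suc.prems by (simp add: inner_edges_insert_edge[where V = V])
    qed
    have "V - {a} = (S - {a}) \<union> (V - S)" using a Suc.prems by blast
    then have "(\<Sum>M\<in>perfect_matchings V. x ^ inner_edges M S) =
        (\<Sum>b\<in>S - {a}. \<Sum>M\<in>perfect_matchings (V - {a, b}). x ^ inner_edges (insert {a, b} M) S) +
        (\<Sum>b\<in>V - S. \<Sum>M\<in>perfect_matchings (V - {a, b}). x ^ inner_edges (insert {a, b} M) S)"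
      using Suc.prems finS
      by (subst sum_perfect_matchings[OF _ a(2)]) (auto intro!: sum.union_disjoint)
    also have "\<dots> = card (S - {a}) * (x * (N * matching_pgf m (l - 1) x))
        + card (V - S) * (N * matching_pgf m l x)"
      by (simp only: inside outside sum_constant cong: sum.cong)
    also have "card (S - {a}) = l"
      using Suc Suc.prems a finS by simp
    also have "real (card (V - S)) = 2 * real m + 1 - real l"
    proof -
      have "card (V - S) = card V - card S" "card S \<le> card V"
        using card_Diff_subset[OF finS Suc.prems(3)] card_mono[OF Suc.prems(1,3)] by simp_all
      then show ?thesis using Suc Suc.prems by simp
    qed
    also have "l * (x * (N * matching_pgf m (l - 1) x))
        + (2 * real m + 1 - real l) * (N * matching_pgf m l x)
        = card (perfect_matchings V) * matching_pgf (Suc m) k x"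
      by (simp add: NV Suc field_simps)
    finally show ?thesis .
  qed
qed

section \<open>Monotonicity in the size of the set\<close>

lemma inner_edges_mono:
  assumes "finite M" "S \<subseteq> T"
  shows "inner_edges M S \<le> inner_edges M T"
  unfolding inner_edges_def using assms by (intro card_mono) auto

text \<open>All sizes \<open>k\<close> are realised by nested sets \<open>{..<k}\<close> over the
  same matchings, so two sizes can be compared summand by summand.\<close>

lemma matching_pgf_eq_average:
  assumes "k \<le> 2 * m"
  shows "matching_pgf m k x = (\<Sum>M\<in>perfect_matchings {..<2 * m}. x ^ inner_edges M {..<k})
    / (\<Prod>i<m. 2 * i + 1)"
proof -
  have "(\<Prod>i<m. 2 * i + 1) \<noteq> (0::nat)" by simp
  moreover have "card (perfect_matchings {..<2 * m}) = (\<Prod>i<m. 2 * i + 1)"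
    by (rule card_perfect_matchings) auto
  ultimately show ?thesis
    using sum_power_inner_edges[of "{..<2 * m}" m "{..<k}" k x] assms
    by (simp del: of_nat_prod)
qed

lemma matching_pgf_mono:
  assumes "1 \<le> x" "Suc k \<le> 2 * m"
  shows "matching_pgf m k x \<le> matching_pgf m (Suc k) x"
proof -
  have "(\<Sum>M\<in>perfect_matchings {..<2 * m}. x ^ inner_edges M {..<k})
      \<le> (\<Sum>M\<in>perfect_matchings {..<2 * m}. x ^ inner_edges M {..<Suc k})"
    using assms
    by (intro sum_mono power_increasing inner_edges_mono perfect_matching_finite[of "{..<2 * m}"]) auto
  then show ?thesis
    using assms by (simp add: matching_pgf_eq_average divide_right_mono del: of_nat_prod)
qed

lemma matching_pgf_antimono:
  assumes "0 \<le> x" "x \<le> 1" "Suc k \<le> 2 * m"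
  shows "matching_pgf m (Suc k) x \<le> matching_pgf m k x"
proof -
  have "(\<Sum>M\<in>perfect_matchings {..<2 * m}. x ^ inner_edges M {..<Suc k})
      \<le> (\<Sum>M\<in>perfect_matchings {..<2 * m}. x ^ inner_edges M {..<k})"
    using assms
    by (intro sum_mono power_decreasing inner_edges_mono perfect_matching_finite[of "{..<2 * m}"]) auto
  then show ?thesis
    using assms by (simp add: matching_pgf_eq_average divide_right_mono del: of_nat_prod)
qed

lemma matching_pgf_nonneg:
  assumes "0 \<le> x" "k \<le> 2 * m"
  shows "0 \<le> matching_pgf m k x"
  using assms by (simp add: matching_pgf_eq_average sum_nonneg del: of_nat_prod)

lemma matching_pgf_at_1 [simp]:
  assumes "k \<le> 2 * m"
  shows "matching_pgf m k 1 = 1"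
proof -
  have "card (perfect_matchings {..<2 * m}) = (\<Prod>i<m. 2 * i + 1)"
    by (rule card_perfect_matchings) auto
  moreover have "(\<Prod>i<m. 2 * i + 1) \<noteq> (0::nat)" by simp
  ultimately show ?thesis
    using assms by (simp add: matching_pgf_eq_average del: of_nat_prod)
qed

text \<open>By the recursion the left side is a weighted mean of
  \<open>x * matching_pgf m k x\<close> and \<open>matching_pgf m (Suc k) x\<close>, with weights
  \<open>k + 1\<close> and \<open>2 * m - k\<close>. For \<open>x \<le> 1\<close> neither exceeds
  \<open>matching_pgf m k x\<close>.\<close>

lemma matching_pgf_pair_removed_ge:
  assumes "0 \<le> x" "x \<le> 1" "Suc (Suc k) \<le> 2 * Suc m"
  shows "matching_pgf (Suc m) (Suc (Suc k)) x \<le> matching_pgf m k x"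
proof -
  have "x * matching_pgf m k x \<le> matching_pgf m k x"
    using assms matching_pgf_nonneg[of x k m] by (simp add: mult_left_le_one_le)
  then have "(real k + 1) * (x * matching_pgf m k x) \<le> (real k + 1) * matching_pgf m k x"
    by (intro mult_left_mono) auto
  moreover have "(2 * real m - real k) * matching_pgf m (Suc k) x
      \<le> (2 * real m - real k) * matching_pgf m k x"
  \<comment> \<open>Monotonicity reaches only sizes up to \<open>2 * m\<close>; in the remaining
    case \<open>k = 2 * m\<close> the weight is zero.\<close>
  proof (cases "Suc k \<le> 2 * m")
    case True
    then show ?thesis using matching_pgf_antimono[OF assms(1,2)] by (intro mult_left_mono) auto
  next
    case False
    then have "k = 2 * m" using assms by simp
    then show ?thesis by simp
  qed
  ultimately show ?thesis
    by (simp add: field_simps)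
qed

text \<open>The same weighted mean; for \<open>1 \<le> x\<close> both comparisons are
  reversed.\<close>

lemma matching_pgf_pair_removed_le:
  assumes "1 \<le> x" "Suc (Suc k) \<le> 2 * Suc m"
  shows "matching_pgf m k x \<le> matching_pgf (Suc m) (Suc (Suc k)) x"
proof -
  have "matching_pgf m k x \<le> x * matching_pgf m k x"
    using assms matching_pgf_nonneg[of x k m] by (simp add: mult_le_cancel_right1)
  then have "(real k + 1) * matching_pgf m k x \<le> (real k + 1) * (x * matching_pgf m k x)"
    by (intro mult_left_mono) auto
  moreover have "(2 * real m - real k) * matching_pgf m k x
      \<le> (2 * real m - real k) * matching_pgf m (Suc k) x"
  proof (cases "Suc k \<le> 2 * m")
    case True
    then show ?thesis using matching_pgf_mono[OF assms(1)] by (intro mult_left_mono) auto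
  next
    case False
    then have "k = 2 * m" using assms by simp
    then show ?thesis by simp
  qed
  ultimately show ?thesis
    by (simp add: field_simps)
qed

section \<open>Derivative and Poisson bound\<close>

text \<open>Differentiation marks one inner edge: each of the k(k-1)/2 pairs is an edge with
  probability 1/(2m-1), and deleting it leaves 2m-2 vertices, k-2 of them in the set. The proof
  checks this through the recursion. For \<open>k < 2\<close> the factor vanishes, so the truncated
  \<open>k - 2\<close> is harmless.\<close>

lemma DERIV_matching_pgf:
  assumes "k \<le> 2 * m"
  shows "((matching_pgf m k) has_real_derivative
    real k * (real k - 1) / (2 * (2 * real m - 1)) * matching_pgf (m - 1) (k - 2) x) (at x)"
  using assms
proof (induction m arbitrary: k)
  case 0
  have "matching_pgf 0 k = (\<lambda>x. 1)" by auto
  then show ?case using 0 by simp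
next
  case (Suc m)
  show ?case
  proof (cases k)
    case 0
    have "matching_pgf (Suc m) 0 = (\<lambda>x. 1)" by auto
    then show ?thesis using 0 by simp
  next
    case (Suc l)
    show ?thesis
    proof (cases "l = 0")
      case True
      have "matching_pgf (Suc m) (Suc 0) = (\<lambda>x. 1)" by (auto simp: fun_eq_iff)
      then show ?thesis using True Suc by simp
    next
      case False
      then obtain j where l: "l = Suc j" using not0_implies_Suc by blast
      have jm: "j \<le> 2 * m" using Suc l Suc.prems by simp
      define A where "A = matching_pgf m j"
      define B where "B = matching_pgf m (Suc j)"
      define A' where "A' = real j * (real j - 1) / (2 * (2 * real m - 1)) * matching_pgf (m - 1) (j - 2) x"
      define B' where "B' = (real j + 1) * real j / (2 * (2 * real m - 1)) * matching_pgf (m - 1) (j - 1) x"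
      have dA: "(A has_real_derivative A') (at x)"
        unfolding A_def A'_def using Suc.IH[OF jm] .
      have dB: "((\<lambda>x. (2 * real m - real j) * B x) has_real_derivative (2 * real m - real j) * B') (at x)"
      \<comment> \<open>At \<open>j = 2 * m\<close> the size \<open>Suc j\<close> is beyond the
        induction hypothesis, but the coefficient of \<open>B\<close> is zero.\<close>
      proof (cases "j = 2 * m")
        case True
        then show ?thesis by simp
      next
        case False
        then have "(B has_real_derivative B') (at x)"
          unfolding B_def B'_def using Suc.IH[of "Suc j"] jm by (simp add: add.commute)
        then show ?thesis by (rule DERIV_cmult)
      qed
      have eq: "matching_pgf (Suc m) k = (\<lambda>x. ((real j + 1) * (x * A x) + (2 * real m - real j) * B x) / (2 * real m + 1))"
        by (auto simp: fun_eq_iff Suc l A_def B_def)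
      have "(matching_pgf (Suc m) k has_real_derivative
         ((real j + 1) * (1 * A x + A' * x) + (2 * real m - real j) * B') / (2 * real m + 1)) (at x)"
        unfolding eq
        by (intro DERIV_cdivide DERIV_add DERIV_cmult DERIV_mult DERIV_ident dA dB)
      \<comment> \<open>\<open>A'\<close> and \<open>B'\<close> contain exactly the two functions in
        the recursion of \<open>A\<close>, so this is that recursion multiplied by (j+1)j/2. Adding
        the product-rule term (j+1) \<open>A x\<close> gives the required (j+2)(j+1)/2.\<close>
      moreover have step: "(real j + 1) * (x * A') + (2 * real m - real j) * B' = (real j + 1) * (real j / 2 * A x)"
      proof (cases m)
        case 0
        then show ?thesis using jm by (simp add: A'_def)
      next
        case m: (Suc p)
        show ?thesis
        proof (cases j)
          case 0
          then show ?thesis by (simp add: A'_def B'_def)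
        next
          case j: (Suc i)
          define P where "P = matching_pgf p (i - 1) x"
          define Q where "Q = matching_pgf p i x"
          have p: "2 * real p + 1 \<noteq> 0" by linarith
          have 1: "A' = (real i + 1) * real i / (2 * (2 * real p + 1)) * P"
            by (simp add: A'_def P_def m j add.commute)
          have 2: "B' = (real i + 2) * (real i + 1) / (2 * (2 * real p + 1)) * Q"
            by (simp add: B'_def Q_def m j add.commute)
          have 3: "A x = (real i * x * P + (2 * real p + 1 - real i) * Q) / (2 * real p + 1)"
            by (simp add: A_def m j P_def Q_def)
          have 4: "real j = real i + 1" "real m = real p + 1" using m j by auto
          show ?thesis
            unfolding 1 2 3 4 using p by (simp add: divide_simps) algebra
        qed
      qed
      moreover have "((real j + 1) * (1 * A x + A' * x) + (2 * real m - real j) * B') / (2 * real m + 1)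
          = real k * (real k - 1) / (2 * (2 * real (Suc m) - 1)) * matching_pgf (Suc m - 1) (k - 2) x"
      proof -
        have "(real j + 1) * (1 * A x + A' * x) + (2 * real m - real j) * B'
            = (real j + 1) * A x + ((real j + 1) * (x * A') + (2 * real m - real j) * B')"
          by (simp add: algebra_simps)
        also have "\<dots> = (real j + 2) * (real j + 1) / 2 * A x"
          unfolding step by (simp add: field_simps)
        finally have num: "(real j + 1) * (1 * A x + A' * x) + (2 * real m - real j) * B'
            = (real j + 2) * (real j + 1) / 2 * A x" .
        have "matching_pgf (Suc m - 1) (k - 2) x = A x" "real k = real j + 2"
          by (simp_all add: Suc l A_def)
        then show ?thesis
          unfolding num by (simp add: field_simps)
      qed
      ultimately show ?thesis by simp
    qed
  qed
qed

definition inner_mean :: "nat \<Rightarrow> nat \<Rightarrow> real" where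
  "inner_mean m k = real k * (real k - 1) / (2 * (2 * real m - 1))"

text \<open>The bound is the generating function of a Poisson variable with mean
  \<open>inner_mean m k\<close>. The quotient \<open>g\<close> of the two sides increases up to 1
  and decreases after it, and its value at 1 is 1. For \<open>k < 2\<close> both sides equal
  1.\<close>

lemma matching_pgf_le_exp:
  assumes "0 \<le> x" "k \<le> 2 * m"
  shows "matching_pgf m k x \<le> exp (inner_mean m k * (x - 1))"
proof (cases "k < 2")
  case True
  then have "k = 0 \<or> k = Suc 0" by auto
  moreover have "matching_pgf m (Suc 0) x = 1" by (cases m) auto
  ultimately show ?thesis by (auto simp: inner_mean_def)
next
  case False
  then obtain j where k: "k = Suc (Suc j)"
    by (metis add_2_eq_Suc le_Suc_ex not_less)
  moreover obtain p where "m = Suc p"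
    using assms k by (cases m) auto
  ultimately have mk: "m = Suc p" "k = Suc (Suc j)" by simp_all
  define \<mu> where "\<mu> = inner_mean m k"
  have "\<mu> \<ge> 0" by (simp add: \<mu>_def inner_mean_def mk)
  define g where "g = (\<lambda>y. matching_pgf m k y * exp (- \<mu> * (y - 1)))"
  define g' where "g' = (\<lambda>y. \<mu> * exp (- \<mu> * (y - 1)) * (matching_pgf p j y - matching_pgf m k y))"
  have d: "(g has_real_derivative g' y) (at y)" for y
  proof -
    have "(matching_pgf m k has_real_derivative \<mu> * matching_pgf p j y) (at y)"
      using DERIV_matching_pgf[OF assms(2), of y] by (simp add: \<mu>_def inner_mean_def mk)
    then show ?thesis
      unfolding g_def g'_def
      by (auto intro!: derivative_eq_intros simp: algebra_simps)
  qed
  have "g x \<le> g 1"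
  proof (cases "x \<le> 1")
    case True
    show ?thesis
    proof (rule DERIV_nonneg_imp_nondecreasing[OF True])
      fix y assume y: "x \<le> y" "y \<le> 1"
      have "0 \<le> g' y"
        using matching_pgf_pair_removed_ge[of y j p] y assms mk \<open>\<mu> \<ge> 0\<close>
        unfolding g'_def by (intro mult_nonneg_nonneg) auto
      then show "\<exists>z. (g has_real_derivative z) (at y) \<and> 0 \<le> z" using d by blast
    qed
  next
    case False
    show ?thesis
    proof (rule DERIV_nonpos_imp_nonincreasing[of 1 x])
      show "1 \<le> x" using False by simp
      fix y assume y: "1 \<le> y" "y \<le> x"
      have "g' y \<le> 0"
        using matching_pgf_pair_removed_le[of y j p] y assms mk \<open>\<mu> \<ge> 0\<close>
        unfolding g'_def by (intro mult_nonneg_nonpos) auto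
      then show "\<exists>z. (g has_real_derivative z) (at y) \<and> z \<le> 0" using d by blast
    qed
  qed
  then have "matching_pgf m k x * exp (- \<mu> * (x - 1)) \<le> 1"
    using assms by (simp add: g_def)
  then have "matching_pgf m k x * exp (- \<mu> * (x - 1)) * exp (\<mu> * (x - 1)) \<le> 1 * exp (\<mu> * (x - 1))"
    by (intro mult_right_mono) auto
  then show ?thesis
    by (simp add: mult.assoc exp_add[symmetric] \<mu>_def)
qed

section \<open>Moments for one uniform matching\<close>

lemma expectation_power_inner_edges:
  fixes x :: real
  assumes "finite V" "card V = 2 * m" "S \<subseteq> V" "card S = k"
  shows "measure_pmf.expectation (pmf_of_set (perfect_matchings V)) (\<lambda>M. x ^ inner_edges M S)
    = matching_pgf m k x"
proof -
  have "card (perfect_matchings V) \<noteq> 0"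
    using card_perfect_matchings[OF assms(1,2)] by simp
  then show ?thesis
    using sum_power_inner_edges[OF assms, of x] finite_perfect_matchings[OF assms(1)]
    by (subst integral_pmf_of_set) auto
qed

text \<open>The mean is the derivative of the generating function at 1. That derivative is computed
  twice, termwise and by \<open>DERIV_matching_pgf\<close>, and the results are equated.\<close>

lemma expectation_inner_edges:
  assumes "finite V" "card V = 2 * m" "S \<subseteq> V" "card S = k"
  shows "measure_pmf.expectation (pmf_of_set (perfect_matchings V)) (\<lambda>M. real (inner_edges M S))
    = inner_mean m k"
proof -
  let ?PM = "perfect_matchings V"
  have k: "k \<le> 2 * m" using assms card_mono by metis
  have N: "card ?PM \<noteq> 0"
    using card_perfect_matchings[OF assms(1,2)] by simp
  have "((\<lambda>x. \<Sum>M\<in>?PM. x ^ inner_edges M S) has_real_derivative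
      (\<Sum>M\<in>?PM. real (inner_edges M S))) (at 1)"
    by (auto intro!: derivative_eq_intros)
  moreover have "((\<lambda>x. \<Sum>M\<in>?PM. x ^ inner_edges M S) has_real_derivative
      card ?PM * inner_mean m k) (at 1)"
  proof -
    have "matching_pgf (m - 1) (k - 2) 1 = 1" using k by simp
    then have "(matching_pgf m k has_real_derivative inner_mean m k) (at 1)"
      using DERIV_matching_pgf[OF k, of 1] by (simp add: inner_mean_def)
    then show ?thesis
      unfolding sum_power_inner_edges[OF assms] by (rule DERIV_cmult)
  qed
  ultimately have "(\<Sum>M\<in>?PM. real (inner_edges M S)) = card ?PM * inner_mean m k"
    by (rule DERIV_unique)
  then show ?thesis
    using N finite_perfect_matchings[OF assms(1)]
    by (subst integral_pmf_of_set) auto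
qed

section \<open>From matchings to cuts of their union\<close>

text \<open>Each vertex of \<open>S\<close> lies in exactly one edge; a cut edge covers one vertex
  of \<open>S\<close>, an inner edge two.\<close>

lemma cut_size_perfect_matching:
  assumes "finite V" "S \<subseteq> V" "M \<in> perfect_matchings V"
  shows "cut_size (mset_set M) S + 2 * inner_edges M S = card S"
proof -
  have fin: "finite M" using perfect_matching_finite assms by blast
  have M: "\<Union>M = V" "disjoint M" "\<And>e. e \<in> M \<Longrightarrow> card e = 2"
    using assms(3) by (auto simp: perfect_matchings_def partition_on_def)
  have finS: "finite S" using assms finite_subset by blast
  have "S = (\<Union>e\<in>M. e \<inter> S)" using M assms by blast
  then have "card S = card (\<Union>e\<in>M. e \<inter> S)" by simp
  also have "\<dots> = (\<Sum>e\<in>M. card (e \<inter> S))"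
  proof (rule card_UN_disjoint[OF fin])
    show "\<forall>e\<in>M. finite (e \<inter> S)" using finS by blast
    show "\<forall>e\<in>M. \<forall>f\<in>M. e \<noteq> f \<longrightarrow> (e \<inter> S) \<inter> (f \<inter> S) = {}"
      using disjointD[OF M(2)] by blast
  qed
  also have "\<dots> = (\<Sum>e\<in>M. of_bool (card (e \<inter> S) = 1) + 2 * of_bool (e \<subseteq> S))"
  proof (rule sum.cong[OF refl])
    fix e assume e: "e \<in> M"
    then have fe: "finite e" using M(3)[OF e] card.infinite by fastforce
    have le: "card (e \<inter> S) \<le> 2" using card_mono[OF fe, of "e \<inter> S"] M(3)[OF e] by simp
    have "e \<subseteq> S \<longleftrightarrow> card (e \<inter> S) = 2"
      using card_subset_eq[OF fe, of "e \<inter> S"] M(3)[OF e] by (metis inf.absorb_iff1 inf_le1)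
    moreover have "card (e \<inter> S) = 0 \<or> card (e \<inter> S) = 1 \<or> card (e \<inter> S) = 2" using le by linarith
    ultimately show "card (e \<inter> S) = of_bool (card (e \<inter> S) = 1) + 2 * of_bool (e \<subseteq> S)"
      by auto
  qed
  also have "\<dots> = card {e \<in> M. card (e \<inter> S) = 1} + 2 * card {e \<in> M. e \<subseteq> S}"
    using fin by (simp add: sum.distrib sum_distrib_left[symmetric] sum_of_bool_eq Int_def)
  also have "card {e \<in> M. card (e \<inter> S) = 1} = cut_size (mset_set M) S"
    using fin by (simp add: cut_size_def)
  finally show ?thesis by (simp add: inner_edges_def)
qed

lemma cut_size_sum: "cut_size (\<Sum>i<d. A i) S = (\<Sum>i<(d::nat). cut_size (A i) S)"
  by (induction d) (simp_all add: cut_size_def)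

text \<open>The sample space behind \<open>G_reg\<close>. It keeps the independent matchings apart,
  which their multiset sum forgets.\<close>

definition matchings_pmf :: "nat \<Rightarrow> nat \<Rightarrow> (nat \<Rightarrow> nat set set) pmf" where
  "matchings_pmf n d = Pi_pmf {..<d} {} (\<lambda>_. pmf_of_set (perfect_matchings {1..n}))"

definition inner_total :: "nat \<Rightarrow> nat set \<Rightarrow> (nat \<Rightarrow> nat set set) \<Rightarrow> nat" where
  "inner_total d S M = (\<Sum>i<d. inner_edges (M i) S)"

lemma set_matchings_pmf:
  assumes "even n" "M \<in> set_pmf (matchings_pmf n d)" "i < d"
  shows "M i \<in> perfect_matchings {1..n}"
proof -
  have "M \<in> PiE_dflt {..<d} {} (\<lambda>_. perfect_matchings {1..n})"
    using assms perfect_matchings_nonempty[OF assms(1)]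
    by (simp add: matchings_pmf_def set_Pi_pmf finite_perfect_matchings comp_def)
  then show ?thesis
    using assms(3) by (auto simp: PiE_dflt_def)
qed

text \<open>Finite support makes every real function integrable, as linearity and Markov's
  inequality require.\<close>

lemma finite_set_matchings_pmf:
  assumes "even n"
  shows "finite (set_pmf (matchings_pmf n d))"
  using perfect_matchings_nonempty[OF assms]
  by (auto simp: matchings_pmf_def set_Pi_pmf finite_perfect_matchings comp_def
      intro!: finite_PiE_dflt)

text \<open>Reduces deviations of the cut to deviations of \<open>inner_total\<close>, with a factor
  2 and the opposite sign.\<close>

lemma cut_size_eq_inner_total:
  assumes "even n" "S \<subseteq> {1..n}" "M \<in> set_pmf (matchings_pmf n d)"
  shows "real (cut_size (\<Sum>i<d. mset_set (M i)) S) = real d * card S - 2 * inner_total d S M"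
proof -
  have "(\<Sum>i<d. cut_size (mset_set (M i)) S + 2 * inner_edges (M i) S) = (\<Sum>i<d. card S)"
    using cut_size_perfect_matching[OF _ assms(2) set_matchings_pmf[OF assms(1,3)]]
    by (intro sum.cong) auto
  then have "cut_size (\<Sum>i<d. mset_set (M i)) S + 2 * inner_total d S M = d * card S"
    by (simp add: cut_size_sum inner_total_def sum.distrib sum_distrib_left)
  then have "real (cut_size (\<Sum>i<d. mset_set (M i)) S + 2 * inner_total d S M) = real (d * card S)"
    by simp
  then show ?thesis by simp
qed

lemma expectation_cut_size:
  assumes n: "n = 2 * m" and S: "S \<subseteq> {1..n}" "card S = k"
  shows "measure_pmf.expectation (G_reg n d) (\<lambda>H. real (cut_size H S))
    = real d * k - 2 * (real d * inner_mean m k)"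
proof -
  have ev: "even n" using n by simp
  have int: "integrable (measure_pmf (matchings_pmf n d)) f" for f :: "_ \<Rightarrow> real"
    by (rule integrable_measure_pmf_finite[OF finite_set_matchings_pmf[OF ev]])
  have "measure_pmf.expectation (matchings_pmf n d) (\<lambda>M. real (inner_edges (M i) S))
      = inner_mean m k" if "i < d" for i
  proof -
    have "measure_pmf.expectation (matchings_pmf n d) (\<lambda>M. real (inner_edges (M i) S))
      = measure_pmf.expectation (map_pmf (\<lambda>M. M i) (matchings_pmf n d)) (\<lambda>M. real (inner_edges M S))"
      by simp
    also have "map_pmf (\<lambda>M. M i) (matchings_pmf n d) = pmf_of_set (perfect_matchings {1..n})"
      using that by (simp add: matchings_pmf_def Pi_pmf_component)
    finally show ?thesis
      using expectation_inner_edges[of "{1..n}" m S k] n S by simp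
  qed
  then have tot: "measure_pmf.expectation (matchings_pmf n d) (\<lambda>M. real (inner_total d S M))
      = real d * inner_mean m k"
    using int by (simp add: inner_total_def)
  have "measure_pmf.expectation (G_reg n d) (\<lambda>H. real (cut_size H S))
      = measure_pmf.expectation (matchings_pmf n d) (\<lambda>M. real (cut_size (\<Sum>i<d. mset_set (M i)) S))"
    by (simp add: G_reg_def matchings_pmf_def)
  also have "\<dots> = measure_pmf.expectation (matchings_pmf n d) (\<lambda>M. real d * k - 2 * inner_total d S M)"
    using cut_size_eq_inner_total[OF ev S(1)] S(2)
    by (intro integral_cong_AE) (auto simp: AE_measure_pmf_iff)
  also have "\<dots> = real d * k - 2 * (real d * inner_mean m k)"
    using int tot by simp
  finally show ?thesis .
qed

section \<open>Chernoff bound for the inner edges\<close>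

text \<open>Independence factors the exponential moment into \<open>d\<close> generating functions
  at \<open>exp c\<close>, each under the Poisson bound.\<close>

lemma expectation_exp_inner_total:
  assumes n: "n = 2 * m" and S: "S \<subseteq> {1..n}" "card S = k"
  shows "measure_pmf.expectation (matchings_pmf n d) (\<lambda>M. exp (c * real (inner_total d S M)))
    \<le> exp (real d * inner_mean m k * (exp c - 1))"
proof -
  have k: "k \<le> 2 * m" using S n card_mono[of "{1..n}" S] by simp
  have fin: "finite (set_pmf (pmf_of_set (perfect_matchings {1..n})))"
    using perfect_matchings_nonempty[of n] n by (subst set_pmf_of_set) (auto simp: finite_perfect_matchings)
  have "(\<lambda>M. exp (c * real (inner_total d S M))) = (\<lambda>M. \<Prod>i<d. exp c ^ inner_edges (M i) S)"
    by (auto simp: fun_eq_iff inner_total_def exp_of_nat2_mult exp_sum sum_distrib_left)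
  then have "measure_pmf.expectation (matchings_pmf n d) (\<lambda>M. exp (c * real (inner_total d S M)))
    = (\<Prod>i<d. measure_pmf.expectation (pmf_of_set (perfect_matchings {1..n})) (\<lambda>M. exp c ^ inner_edges M S))"
    unfolding matchings_pmf_def
    by (simp only:, subst expectation_prod_Pi_pmf)
       (auto intro!: integrable_measure_pmf_finite fin[simplified])
  also have "\<dots> = matching_pgf m k (exp c) ^ d"
    using expectation_power_inner_edges[of "{1..n}" m S k "exp c"] n S by simp
  also have "\<dots> \<le> exp (inner_mean m k * (exp c - 1)) ^ d"
    using k by (intro power_mono matching_pgf_le_exp matching_pgf_nonneg) auto
  also have "\<dots> = exp (real d * inner_mean m k * (exp c - 1))"
    by (simp add: exp_of_nat_mult[symmetric] mult.assoc)
  finally show ?thesis .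
qed

text \<open>Markov's inequality for the exponential. The event is kept multiplied by
  \<open>c\<close>, so that positive \<open>c\<close> gives the upper tail and negative
  \<open>c\<close> the lower one.\<close>

lemma inner_total_Chernoff:
  fixes d :: nat and c a :: real
  assumes n: "n = 2 * m" and S: "S \<subseteq> {1..n}" "card S = k"
  defines "\<Lambda> \<equiv> real d * inner_mean m k"
  shows "measure_pmf.prob (matchings_pmf n d) {M. c * \<Lambda> + a \<le> c * real (inner_total d S M)}
    \<le> exp (\<Lambda> * (exp c - 1 - c) - a)"
proof -
  let ?P = "matchings_pmf n d"
  let ?f = "\<lambda>M. exp (c * real (inner_total d S M))"
  have "even n" using n by simp
  have "{M. c * \<Lambda> + a \<le> c * real (inner_total d S M)}
      = {M \<in> space (measure_pmf ?P). exp (c * \<Lambda> + a) \<le> ?f M}"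
    by simp
  then have "measure_pmf.prob ?P {M. c * \<Lambda> + a \<le> c * real (inner_total d S M)}
      \<le> measure_pmf.expectation ?P ?f / exp (c * \<Lambda> + a)"
    using integral_Markov_inequality_measure[of "measure_pmf ?P" ?f "{}" "exp (c * \<Lambda> + a)"]
      integrable_measure_pmf_finite[OF finite_set_matchings_pmf[OF \<open>even n\<close>], of d ?f]
    by simp
  also have "\<dots> \<le> exp (\<Lambda> * (exp c - 1)) / exp (c * \<Lambda> + a)"
    using expectation_exp_inner_total[OF n S, of d c]
    by (intro divide_right_mono) (auto simp: \<Lambda>_def)
  also have "\<dots> = exp (\<Lambda> * (exp c - 1 - c) - a)"
    by (simp add: exp_diff[symmetric] algebra_simps)
  finally show ?thesis .
qed

section \<open>Estimates for the tail exponent\<close>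

lemma exp_sub_linear_le:
  fixes x :: real
  shows "exp x - 1 - x \<le> x\<^sup>2 / 2 * exp \<bar>x\<bar>"
proof -
  obtain t where t: "\<bar>t\<bar> \<le> \<bar>x\<bar>" "exp x = (\<Sum>m<2. x ^ m / fact m) + exp t / fact 2 * x ^ 2"
    using Maclaurin_exp_le[of x 2] by blast
  have "exp x - 1 - x = exp t * (x\<^sup>2 / 2)"
    using t(2) by (simp add: numeral_2_eq_2)
  also have "\<dots> \<le> exp \<bar>x\<bar> * (x\<^sup>2 / 2)"
    using t(1) by (intro mult_right_mono) auto
  finally show ?thesis by (simp add: mult.commute)
qed

text \<open>This is the bound (en/k)^k. It combines \<open>n choose k\<close> \<le> n^k / k! with
  k^k / k! \<le> e^k, the latter because k^k / k! is one term of the exponential series.\<close>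

lemma binomial_le_exp:
  assumes "1 \<le> k" "k \<le> n"
  shows "real (n choose k) \<le> exp (real k * (1 + ln (real n / real k)))"
proof -
  have "real k ^ k / fact k \<le> exp (real k)"
  proof -
    have s: "summable (\<lambda>i. inverse (fact i) * real k ^ i)"
      using summable_exp[of "real k"] by simp
    have "(\<Sum>i\<in>{k}. inverse (fact i) * real k ^ i) \<le> (\<Sum>i. inverse (fact i) * real k ^ i)"
      by (rule sum_le_suminf[OF s]) auto
    then show ?thesis by (simp add: exp_def divide_inverse mult.commute)
  qed
  then have f: "real k ^ k \<le> exp (real k) * fact k"
    by (simp add: field_simps)
  have "real ((n choose k) * fact k) \<le> real (n ^ k)"
    using binomial_fact_pow[of n k] by (rule of_nat_mono)
  then have "real (n choose k) * fact k * real k ^ k \<le> real n ^ k * (exp (real k) * fact k)"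
    using f by (intro mult_mono) auto
  then have "real (n choose k) * real k ^ k \<le> real n ^ k * exp (real k)"
    by (simp add: mult.assoc mult.left_commute[of _ "fact k"] mult_le_cancel_left)
  then have "real (n choose k) \<le> exp (real k) * (real n / real k) ^ k"
    using assms by (simp add: power_divide field_simps)
  also have "(real n / real k) ^ k = exp (real k * ln (real n / real k))"
    using assms by (simp add: exp_of_nat_mult)
  finally show ?thesis
    by (simp add: exp_add[symmetric] algebra_simps)
qed

lemma inner_mean_bounds:
  assumes n: "n = 2 * m" and k: "1 \<le> k" "real k \<le> real n / 100"
  shows "inner_mean m k \<le> real k * (real k / real n) / 2"
    "99 / 100 * real k \<le> real k - 2 * inner_mean m k"
proof -
  have n1: "real n \<ge> 100" using k by linarith
  have eq: "inner_mean m k = real k * ((real k - 1) / (real n - 1)) / 2"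
    by (simp add: inner_mean_def n)
  have b: "(real k - 1) / (real n - 1) \<le> real k / real n"
    using n1 k by (simp add: field_simps)
  have b1: "real k / real n \<le> 1 / 100" using n1 k by (simp add: field_simps)
  show le: "inner_mean m k \<le> real k * (real k / real n) / 2"
    unfolding eq using b by (intro divide_right_mono mult_left_mono) auto
  define q where "q = real k * (real k / real n)"
  have "q \<le> real k * (1 / 100)"
    unfolding q_def using b1 by (intro mult_left_mono) auto
  then show "99 / 100 * real k \<le> real k - 2 * inner_mean m k"
    using le unfolding q_def[symmetric] by linarith
qed

text \<open>The quadratic loss is at most 19/40 of \<open>k * w\<close> and the linear gain at least
  297/200 of it; the difference is exactly 1.01.\<close>

lemma tail_exponent_le:
  fixes c :: real
  assumes n: "n = 2 * m" and k: "1 \<le> k" "real k \<le> real n / 100" and d: "64 \<le> d"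
  defines "\<Lambda> \<equiv> real d * inner_mean m k"
    and "w \<equiv> 1 + ln (real n / real k)"
  assumes c: "\<bar>c\<bar> = 2 * w / sqrt (real d)"
  shows "\<Lambda> * (exp c - 1 - c) - \<bar>c\<bar> * (3 / 4 * (real d * k - 2 * \<Lambda>) / sqrt (real d))
    \<le> - 1.01 * (real k * w)"
proof -
  define D where "D = sqrt (real d)"
  have D: "D \<ge> 8" "D\<^sup>2 = real d"
    using d real_sqrt_le_mono[of 64 "real d"] by (auto simp: D_def)
  have r: "real n / real k \<ge> 100" using k by (simp add: field_simps)
  have w1: "w \<ge> 1" unfolding w_def using r by simp
  have ew: "exp w = exp 1 * (real n / real k)"
    unfolding w_def using r k by (simp add: exp_add)
  have e1: "exp 1 \<ge> (2::real)" using exp_ge_add_one_self[of 1] by simp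
  have "exp w \<ge> 2 * 100" unfolding ew using r e1 by (intro mult_mono) auto
  \<comment> \<open>\<open>d \<ge> 64\<close> enters here, through \<open>D \<ge> 8\<close>.\<close>
  have cw: "\<bar>c\<bar> \<le> w / 4"
    using D(1) w1 unfolding c D_def[symmetric] by (simp add: field_simps)
  have c2: "c\<^sup>2 = 4 * w\<^sup>2 / d"
  proof -
    have "c\<^sup>2 = \<bar>c\<bar>\<^sup>2" by simp
    also have "\<dots> = 4 * w\<^sup>2 / d"
      unfolding c D_def[symmetric] D(2)[symmetric] by (simp add: power_divide power_mult_distrib)
    finally show ?thesis .
  qed
  have "\<Lambda> * (exp c - 1 - c) \<le> (d * (real k * (real k / real n) / 2)) * (c\<^sup>2 / 2 * exp \<bar>c\<bar>)"
  proof (rule mult_mono)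
    show "\<Lambda> \<le> d * (real k * (real k / real n) / 2)"
      unfolding \<Lambda>_def using inner_mean_bounds(1)[OF n k] by (intro mult_left_mono) auto
    show "0 \<le> exp c - 1 - c" using exp_ge_add_one_self[of c] by linarith
    show "exp c - 1 - c \<le> c\<^sup>2 / 2 * exp \<bar>c\<bar>" by (rule exp_sub_linear_le)
  qed simp
  \<comment> \<open>The choice of \<open>c\<close> as a multiple of 1 / sqrt d makes
    \<open>d\<close> cancel.\<close>
  also have "\<dots> = real k * w * (w * (real k / real n) * exp \<bar>c\<bar>)"
    unfolding c2 using d by (simp add: field_simps power2_eq_square)
  also have "\<dots> \<le> real k * w * (19 / 40)"
  proof (rule mult_left_mono)
    have kn: "real k / real n = exp 1 / exp w"
      unfolding ew using k r by simp
    \<comment> \<open>The tangent of exp at 1, taken at \<open>w / 4\<close>. It trades the factor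
      \<open>w\<close> for \<open>exp (w / 4)\<close>, and \<open>exp \<bar>c\<bar>\<close> costs at
      most as much again, so half of the decay of \<open>k / n = exp 1 / exp w\<close>
      survives.\<close>
    have "exp 1 * (w / 4) \<le> exp (w / 4)"
    proof -
      have "exp 1 * (w / 4) \<le> exp 1 * exp (w / 4 - 1)"
        using exp_ge_add_one_self[of "w / 4 - 1"] by (intro mult_left_mono) auto
      then show ?thesis by (simp add: exp_add[symmetric])
    qed
    then have a: "w * exp 1 \<le> 4 * exp (w / 4)" by (simp add: mult.commute)
    have "w * (real k / real n) * exp \<bar>c\<bar> = (w * exp 1) * exp \<bar>c\<bar> / exp w"
      unfolding kn by simp
    also have "\<dots> \<le> (4 * exp (w / 4)) * exp (w / 4) / exp w"
      using cw by (intro divide_right_mono mult_mono[OF a]) auto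
    also have "\<dots> = 4 / exp (w / 2)"
    proof -
      have "exp w = exp (w / 4) * exp (w / 4) * exp (w / 2)"
        by (simp add: exp_add[symmetric])
      then show ?thesis by simp
    qed
    also have "\<dots> \<le> 19 / 40"
    proof -
      have "(exp (w / 2))\<^sup>2 = exp w" by (simp add: power2_eq_square exp_add[symmetric])
      then have "10\<^sup>2 \<le> (exp (w / 2))\<^sup>2" using \<open>exp w \<ge> 2 * 100\<close> by simp
      then have "10 \<le> exp (w / 2)" by (rule power2_le_imp_le) simp
      then show ?thesis by (simp add: field_simps)
    qed
    finally show "w * (real k / real n) * exp \<bar>c\<bar> \<le> 19 / 40" .
  qed (use w1 in auto)
  finally have A: "\<Lambda> * (exp c - 1 - c) \<le> real k * w * (19 / 40)" .
  \<comment> \<open>297/200 is 2 * 3/4 * 99/100: the factor in \<open>c\<close>, the factor in the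
    threshold, and the lower bound on the mean cut.\<close>
  have B: "real k * w * (297 / 200) \<le> \<bar>c\<bar> * (3 / 4 * (real d * k - 2 * \<Lambda>) / D)"
  proof -
    have "real d * (99 / 100 * real k) \<le> real d * (real k - 2 * inner_mean m k)"
      using inner_mean_bounds(2)[OF n k] by (intro mult_left_mono) auto
    then have "D\<^sup>2 * (99 / 100 * real k) \<le> real d * k - 2 * \<Lambda>"
      unfolding D(2) \<Lambda>_def by (simp add: algebra_simps)
    then have "2 * w / D * (3 / 4 * (D\<^sup>2 * (99 / 100 * real k)) / D)
        \<le> 2 * w / D * (3 / 4 * (real d * k - 2 * \<Lambda>) / D)"
      using D w1 by (intro mult_left_mono divide_right_mono) auto
    moreover have "2 * w / D * (3 / 4 * (D\<^sup>2 * (99 / 100 * real k)) / D) = real k * w * (297 / 200)"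
      using D(1) by (simp add: power2_eq_square)
    ultimately show ?thesis unfolding c D_def[symmetric] by (simp only:)
  qed
  have "P - Q \<le> - 1.01 * z" if "P \<le> z * (19 / 40)" "z * (297 / 200) \<le> Q" for P Q z :: real
    using that by simp
  from this[OF A B] show ?thesis unfolding D_def .
qed

section \<open>Concentration of the cut\<close>

theorem mainTheorem5:
  shows "\<exists>d0::nat. \<forall>d\<ge>d0. \<exists>n0::nat. \<forall>n\<ge>n0. even n \<longrightarrow>
    (\<forall>k::nat. 1 \<le> k \<and> real k \<le> real n / 100 \<longrightarrow>
      (\<forall>S. S \<subseteq> {1..n} \<and> card S = k \<longrightarrow>
        measure_pmf.prob (G_reg n d)
          {H. \<bar>real (cut_size H S) / measure_pmf.expectation (G_reg n d) (\<lambda>H'. real (cut_size H' S)) - 1\<bar>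
                \<le> 1.5 / sqrt (real d)}
        \<ge> 1 - 2 * real (n choose k) powr (-1.01)))"
proof (rule exI[of _ 64], intro allI impI, rule exI[of _ 0], intro allI impI)
  \<comment> \<open>The witness 64 is what \<open>tail_exponent_le\<close> asks of \<open>d\<close>.
    For \<open>n\<close> the witness 0 suffices, since 1 \<le> k \<le> n/100 already forces n \<ge>
    100.\<close>
  fix d n k :: nat and S
  assume d: "64 \<le> d" and ev: "even n" and "1 \<le> k \<and> real k \<le> real n / 100"
    and "S \<subseteq> {1..n} \<and> card S = k"
  then have k: "1 \<le> k" "real k \<le> real n / 100" and S: "S \<subseteq> {1..n}" "card S = k"
    by auto
  obtain m where n: "n = 2 * m" using ev by blast
  let ?P = "matchings_pmf n d"
  let ?X = "\<lambda>M. real (inner_total d S M)"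
  define \<Lambda> where "\<Lambda> = real d * inner_mean m k"
  define E where "E = real d * k - 2 * \<Lambda>"
  define D where "D = sqrt (real d)"
  \<comment> \<open>The cut moves by twice the deviation of \<open>inner_total\<close>, so a
    relative error 1.5 / \<open>D\<close> of the cut corresponds to a deviation of half of 1.5 *
    \<open>E\<close> / \<open>D\<close>.\<close>
  define t where "t = 3 / 4 * E / D"
  define w where "w = 1 + ln (real n / real k)"
  define v where "v = 2 * w / D"
  let ?A = "{H. \<bar>real (cut_size H S) / measure_pmf.expectation (G_reg n d) (\<lambda>H'. real (cut_size H' S)) - 1\<bar>
                \<le> 1.5 / sqrt (real d)}"
  have D: "D > 0" using d by (simp add: D_def)
  have r: "real n / real k \<ge> 100" using k by (simp add: field_simps)
  have "w \<ge> 1" unfolding w_def using r by simp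
  then have v: "v > 0" using D by (simp add: v_def)
  have E0: "E > 0"
  proof -
    have "real k - 2 * inner_mean m k > 0"
      using inner_mean_bounds(2)[OF n k] k by linarith
    then have "real d * (real k - 2 * inner_mean m k) > 0" using d by simp
    then show ?thesis by (simp add: E_def \<Lambda>_def algebra_simps)
  qed
  have EE: "measure_pmf.expectation (G_reg n d) (\<lambda>H'. real (cut_size H' S)) = E"
    using expectation_cut_size[OF n S] by (simp add: E_def \<Lambda>_def)
  define C where "C = real (n choose k) powr (-1.01)"
  \<comment> \<open>Stated for both signs of \<open>c\<close>, so one argument serves both
    tails.\<close>
  have tail: "measure_pmf.prob ?P {M. c * \<Lambda> + v * t \<le> c * ?X M} \<le> C" if c: "\<bar>c\<bar> = v" for c
  proof -
    have "measure_pmf.prob ?P {M. c * \<Lambda> + v * t \<le> c * ?X M} \<le> exp (\<Lambda> * (exp c - 1 - c) - v * t)"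
      unfolding \<Lambda>_def by (rule inner_total_Chernoff[OF n S])
    also have "\<dots> \<le> exp (- 1.01 * (real k * w))"
      using tail_exponent_le[OF n k d, of c] c
      by (simp add: \<Lambda>_def E_def t_def D_def v_def w_def)
    also have "\<dots> = exp (real k * w) powr (-1.01)"
      by (simp add: powr_def)
    also have "\<dots> \<le> C"
      unfolding C_def
    proof (rule powr_mono2')
      have "k \<le> n" using k by linarith
      then show "0 < real (n choose k)" by simp
      show "real (n choose k) \<le> exp (real k * w)"
        unfolding w_def using binomial_le_exp k(1) \<open>k \<le> n\<close> by blast
    qed simp
    finally show ?thesis .
  qed
  \<comment> \<open>A bad cut puts \<open>inner_total\<close> at distance more than \<open>t\<close>
    from \<Lambda>; scaling by \<open>v\<close> turns the two directions into the Chernoff events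
    for \<open>v\<close> and \<open>- v\<close>.\<close>
  have bad: "M \<in> {M. v * \<Lambda> + v * t \<le> v * ?X M} \<union> {M. - v * \<Lambda> + v * t \<le> - v * ?X M}"
    if M: "M \<in> set_pmf ?P" and "(\<Sum>i<d. mset_set (M i)) \<notin> ?A" for M
  proof -
    have cut: "real (cut_size (\<Sum>i<d. mset_set (M i)) S) = E - 2 * (?X M - \<Lambda>)"
      using cut_size_eq_inner_total[OF ev S(1) M] S(2) by (simp add: E_def)
    have "real (cut_size (\<Sum>i<d. mset_set (M i)) S) / E - 1 = - (2 * (?X M - \<Lambda>) / E)"
      unfolding cut using E0 by (simp add: field_simps)
    then have "1.5 / D < \<bar>2 * (?X M - \<Lambda>) / E\<bar>"
      using that(2) by (simp add: EE D_def)
    also have "\<dots> = 2 * \<bar>?X M - \<Lambda>\<bar> / E"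
      using E0 by (simp only: abs_mult abs_divide abs_numeral abs_of_pos)
    finally have "t < \<bar>?X M - \<Lambda>\<bar>"
      using E0 D by (simp add: t_def field_simps)
    then have "\<Lambda> + t \<le> ?X M \<or> ?X M \<le> \<Lambda> - t" by linarith
    then have "v * (\<Lambda> + t) \<le> v * ?X M \<or> v * ?X M \<le> v * (\<Lambda> - t)"
      using v by auto
    then show ?thesis by (auto simp: algebra_simps)
  qed
  have "measure_pmf.prob (G_reg n d) (- ?A)
      = measure_pmf.prob ?P ((\<lambda>M. \<Sum>i<d. mset_set (M i)) -` (- ?A))"
    by (simp add: G_reg_def matchings_pmf_def)
  also have "\<dots> \<le> measure_pmf.prob ?P
      ({M. v * \<Lambda> + v * t \<le> v * ?X M} \<union> {M. - v * \<Lambda> + v * t \<le> - v * ?X M})"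
    by (rule measure_pmf.finite_measure_mono_AE) (use bad in \<open>auto simp: AE_measure_pmf_iff\<close>)
  also have "\<dots> \<le> measure_pmf.prob ?P {M. v * \<Lambda> + v * t \<le> v * ?X M}
      + measure_pmf.prob ?P {M. - v * \<Lambda> + v * t \<le> - v * ?X M}"
    by (rule measure_Un_le) auto
  also have "\<dots> \<le> 2 * C"
    using tail[of v] tail[of "- v"] v by simp
  finally have "measure_pmf.prob (G_reg n d) (- ?A) \<le> 2 * C" .
  moreover have "measure_pmf.prob (G_reg n d) (- ?A) = 1 - measure_pmf.prob (G_reg n d) ?A"
    using measure_pmf.prob_compl[of ?A "G_reg n d"] by (simp add: Compl_eq_Diff_UNIV)
  ultimately show "1 - 2 * real (n choose k) powr (-1.01) \<le> measure_pmf.prob (G_reg n d) ?A"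
    unfolding C_def by linarith
qed

end
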